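(* Let $K$ be a Hausdorff space, let $A$ be a (closed linear) subspace of $C_b(K)$ and let $f\in A$. (i) The norm $\|\cdot\|$ of $A$ is Gâteaux differentiable at $f$ if and only if every norming sequence of $f$ approaches for $A$. (ii) The norm $\|\cdot\|$ of $A$ is Fréchet differentiable at $f$ if and only if every norming sequence of $f$ approaches uniformly for $A$.
   Context: $C_b(K)$ is the complex Banach space of all bounded continuous complex-valued functions on $K$ with norm $\|f\|=\sup_{x\in K}|f(x)|$. "Subspace" means closed linear subspace. $S_A$ is the unit sphere of $A$. The norm of a Banach space $X$ is Gâteaux differentiable (resp. Fréchet differentiable) at $x$ if $\lim_{t\to0}\frac{\|x+ty\|+\|x-ty\|-2\|x\|}{t}=0$ ($t$ real) for every $y\in X$ (resp. uniformly for $y\in S_X$). "Every norming sequence of $f$ approaches for $A$" means: whenever $\{x_n\}_{n=1}^\infty$, $\{y_n\}_{n=1}^\infty$ are sequences in $K$ and $\alpha,\beta$ are complex numbers of modulus $1$ with $\lim_n\alpha f(x_n)=\|f\|=\lim_n\beta f(y_n)$, one has $\lim_n(\alpha g(x_n)-\beta g(y_n))=0$ for every $g\in A$. "Every norming sequence of $f$ approaches uniformly for $A$" means that for all such sequences and scalars, $\lim_n(\alpha g(x_n)-\beta g(y_n))=0$ uniformly for $g\in S_A$. *)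

theory Defs
  imports "HOL-Analysis.Analysis"
begin

(* The space C_b(K) is the library type 'k \<Rightarrow>\<^sub>C complex with its supremum norm.  The library
   only makes it a real normed space, so the complex scalar multiplication is added here. *)

definition scaleC_bcontfun ::
    "complex \<Rightarrow> ('k::topological_space \<Rightarrow>\<^sub>C complex) \<Rightarrow> ('k \<Rightarrow>\<^sub>C complex)" where
  "scaleC_bcontfun c f = Bcontfun (\<lambda>x. c * f x)"

lemma scaleC_bcontfun_apply [simp]: "scaleC_bcontfun c f x = c * f x"
proof -
  have "bounded ((\<lambda>z. c * z) ` range (apply_bcontfun f))"
    by (intro bounded_linear_image bounded_linear_mult_right) simp
  then have "(\<lambda>x. c * f x) \<in> bcontfun"
    by (auto simp: bcontfun_def image_image intro!: continuous_intros)
  then show ?thesis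
    by (simp add: scaleC_bcontfun_def Bcontfun_inverse)
qed

global_interpretation Cb: vector_space
  "scaleC_bcontfun :: complex \<Rightarrow> ('k::topological_space \<Rightarrow>\<^sub>C complex) \<Rightarrow> ('k \<Rightarrow>\<^sub>C complex)"
  by unfold_locales (auto intro!: bcontfun_eqI simp: algebra_simps)

lemma norm_bcontfun_eq_SUP:
  fixes f :: "'k::topological_space \<Rightarrow>\<^sub>C complex"
  shows "norm f = (SUP x. cmod (f x))"
  by (simp add: norm_bcontfun_def dist_bcontfun.rep_eq)

definition closed_subspace :: "('k::topological_space \<Rightarrow>\<^sub>C complex) set \<Rightarrow> bool" where
  "closed_subspace A \<longleftrightarrow> Cb.subspace A \<and> closed A"

(* Differentiability at x of the norm of the subspace X: only directions in X are considered,
   and t is real and nonzero. *)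

definition gateaux_differentiable_norm :: "'a::real_normed_vector set \<Rightarrow> 'a \<Rightarrow> bool" where
  "gateaux_differentiable_norm X x \<longleftrightarrow>
     (\<forall>y\<in>X. ((\<lambda>t::real. (norm (x + t *\<^sub>R y) + norm (x - t *\<^sub>R y) - 2 * norm x) / t)
        \<longlongrightarrow> 0) (at 0))"

definition frechet_differentiable_norm :: "'a::real_normed_vector set \<Rightarrow> 'a \<Rightarrow> bool" where
  "frechet_differentiable_norm X x \<longleftrightarrow>
     uniform_limit (X \<inter> sphere 0 1)
       (\<lambda>(t::real) y. (norm (x + t *\<^sub>R y) + norm (x - t *\<^sub>R y) - 2 * norm x) / t)
       (\<lambda>_. 0) (at 0)"

definition norming_sequence ::
    "('k::topological_space \<Rightarrow>\<^sub>C complex) \<Rightarrow> complex \<Rightarrow> (nat \<Rightarrow> 'k) \<Rightarrow> bool" where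
  "norming_sequence f \<alpha> x \<longleftrightarrow>
     cmod \<alpha> = 1 \<and> (\<lambda>n. \<alpha> * f (x n)) \<longlonglongrightarrow> complex_of_real (norm f)"

definition norming_sequences_approach ::
    "('k::topological_space \<Rightarrow>\<^sub>C complex) set \<Rightarrow> ('k \<Rightarrow>\<^sub>C complex) \<Rightarrow> bool" where
  "norming_sequences_approach A f \<longleftrightarrow>
     (\<forall>x y \<alpha> \<beta>. norming_sequence f \<alpha> x \<and> norming_sequence f \<beta> y \<longrightarrow>
        (\<forall>g\<in>A. (\<lambda>n. \<alpha> * g (x n) - \<beta> * g (y n)) \<longlonglongrightarrow> 0))"

definition norming_sequences_approach_uniformly ::
    "('k::topological_space \<Rightarrow>\<^sub>C complex) set \<Rightarrow> ('k \<Rightarrow>\<^sub>C complex) \<Rightarrow> bool" where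
  "norming_sequences_approach_uniformly A f \<longleftrightarrow>
     (\<forall>x y \<alpha> \<beta>. norming_sequence f \<alpha> x \<and> norming_sequence f \<beta> y \<longrightarrow>
        uniform_limit (A \<inter> sphere 0 1) (\<lambda>n g. \<alpha> * g (x n) - \<beta> * g (y n)) (\<lambda>_. 0) sequentially)"

end

theory Submission
  imports Defs
begin

text \<open>For \<^term>\<open>t > 0\<close>, evaluating \<open>f + t g\<close> along one norming sequence and \<open>f - t g\<close> along another
  bounds the oscillation of \<open>g\<close> by the difference quotient of the norm at \<open>f\<close>. Conversely, a
  difference quotient that stays large for \<open>t\<^sub>n \<longlonglongrightarrow> 0\<close> yields points almost attaining the norms of
  \<open>f \<plusminus> t\<^sub>n g\<^sub>n\<close>; after the phases have been made convergent by compactness of the circle, these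
  points are norming sequences of \<open>f\<close> that do not approach. Both arguments are uniform over the set
  of directions \<open>g\<close>, so the Gateaux and the Frechet case are the same statement for different sets
  of directions.\<close>

section \<open>Symmetric difference quotients of the norm\<close>

definition norm_quotient :: "'a::real_normed_vector \<Rightarrow> real \<Rightarrow> 'a \<Rightarrow> real" where
  "norm_quotient f t g = (norm (f + t *\<^sub>R g) + norm (f - t *\<^sub>R g) - 2 * norm f) / t"

lemma norm_quotient_minus: "norm_quotient f (- t) g = - norm_quotient f t g"
  by (simp add: norm_quotient_def add.commute)

lemma norm_quotient_nonneg:
  assumes "t \<ge> 0"
  shows "norm_quotient f t g \<ge> 0"
proof -
  have "norm ((f + t *\<^sub>R g) + (f - t *\<^sub>R g)) \<le> norm (f + t *\<^sub>R g) + norm (f - t *\<^sub>R g)"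
    by (rule norm_triangle_ineq)
  also have "(f + t *\<^sub>R g) + (f - t *\<^sub>R g) = 2 *\<^sub>R f"
    by (simp add: scaleR_2)
  finally show ?thesis
    using assms by (simp add: norm_quotient_def)
qed

text \<open>The quotient is odd in \<open>t\<close>, and convexity of the norm makes it nonnegative
  for \<open>t \<ge> 0\<close>. Failure of the two-sided limit can therefore always be witnessed by
  positive \<open>t\<close>.\<close>

lemma abs_norm_quotient: "\<bar>norm_quotient f t g\<bar> = norm_quotient f \<bar>t\<bar> g"
  using norm_quotient_nonneg[of "\<bar>t\<bar>" f g] norm_quotient_minus[of f t g]
  by (cases "t \<ge> 0") auto

lemma gateaux_differentiable_norm_iff:
  "gateaux_differentiable_norm A f \<longleftrightarrow>
    (\<forall>g\<in>A. uniform_limit {g} (norm_quotient f) (\<lambda>_. 0) (at 0))"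
  by (simp add: gateaux_differentiable_norm_def norm_quotient_def uniform_limit_singleton)

lemma frechet_differentiable_norm_iff:
  "frechet_differentiable_norm A f \<longleftrightarrow>
    uniform_limit (A \<inter> sphere 0 1) (norm_quotient f) (\<lambda>_. 0) (at 0)"
  by (simp add: frechet_differentiable_norm_def norm_quotient_def[abs_def])

text \<open>The set of directions is a parameter: singletons \<open>{g}\<close> give the pointwise
  notion, \<open>A \<inter> sphere 0 1\<close> the uniform one.\<close>

definition norming_sequences_approach_on ::
    "('k::topological_space \<Rightarrow>\<^sub>C complex) set \<Rightarrow> ('k \<Rightarrow>\<^sub>C complex) \<Rightarrow> bool" where
  "norming_sequences_approach_on S f \<longleftrightarrow>
     (\<forall>x y \<alpha> \<beta>. norming_sequence f \<alpha> x \<and> norming_sequence f \<beta> y \<longrightarrow>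
        uniform_limit S (\<lambda>n g. \<alpha> * g (x n) - \<beta> * g (y n)) (\<lambda>_. 0) sequentially)"

lemma norming_sequences_approach_iff:
  "norming_sequences_approach A f \<longleftrightarrow> (\<forall>g\<in>A. norming_sequences_approach_on {g} f)"
  by (auto simp: norming_sequences_approach_def norming_sequences_approach_on_def
      uniform_limit_singleton)

section \<open>From differentiability to approaching norming sequences\<close>

lemma Re_mult_le_norm_bcontfun:
  fixes f :: "'k::topological_space \<Rightarrow>\<^sub>C complex"
  assumes "cmod \<alpha> = 1"
  shows "Re (\<alpha> * f x) \<le> norm f"
proof -
  have "Re (\<alpha> * f x) \<le> cmod (\<alpha> * f x)"
    by (rule complex_Re_le_cmod)
  also have "\<dots> \<le> norm f"
    using norm_bounded[of f x] by (simp add: norm_mult assms)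
  finally show ?thesis .
qed

text \<open>Evaluate \<open>f + t g\<close> at \<open>x\<close> with phase \<alpha> and
  \<open>f - t g\<close> at \<open>y\<close> with phase \<beta>; the real parts are bounded by the
  two norms. The last summand measures how far both points are from norming \<open>f\<close>.
  Exchanging the two points gives the opposite sign, hence the absolute value.\<close>

lemma Re_diff_le_norm_quotient:
  fixes f g :: "'k::topological_space \<Rightarrow>\<^sub>C complex"
  assumes "cmod \<alpha> = 1" "cmod \<beta> = 1" "t > 0"
  shows "\<bar>Re (\<alpha> * g x - \<beta> * g y)\<bar>
    \<le> norm_quotient f t g + (2 * norm f - Re (\<alpha> * f x + \<beta> * f y)) / t"
proof -
  have *: "Re (\<gamma> * g u - \<delta> * g v)
      \<le> norm_quotient f t g + (2 * norm f - Re (\<gamma> * f u + \<delta> * f v)) / t"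
    if "cmod \<gamma> = 1" "cmod \<delta> = 1" for \<gamma> \<delta> u v
  proof -
    have "Re (\<gamma> * (f + t *\<^sub>R g) u) + Re (\<delta> * (f - t *\<^sub>R g) v)
        \<le> norm (f + t *\<^sub>R g) + norm (f - t *\<^sub>R g)"
      using that by (intro add_mono Re_mult_le_norm_bcontfun)
    then have "t * Re (\<gamma> * g u - \<delta> * g v)
        \<le> norm (f + t *\<^sub>R g) + norm (f - t *\<^sub>R g) - Re (\<gamma> * f u + \<delta> * f v)"
      by (simp add: algebra_simps)
    then have "Re (\<gamma> * g u - \<delta> * g v)
        \<le> (norm (f + t *\<^sub>R g) + norm (f - t *\<^sub>R g) - Re (\<gamma> * f u + \<delta> * f v)) / t"
      using \<open>t > 0\<close> by (simp only: pos_le_divide_eq mult.commute)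
    also have "\<dots> = norm_quotient f t g + (2 * norm f - Re (\<gamma> * f u + \<delta> * f v)) / t"
      unfolding norm_quotient_def add_divide_distrib[symmetric] by simp
    finally show ?thesis .
  qed
  show ?thesis
    using *[of \<alpha> \<beta> x y] *[of \<beta> \<alpha> y x] assms by (simp add: add.commute)
qed

text \<open>The preceding estimate controls real parts only. Applied to \<open>\<i> g\<close> it
  controls the imaginary part for \<open>g\<close>, which is why the hypothesis includes the
  directions \<open>\<i> g\<close>.\<close>

lemma norming_sequences_approach_on_if_uniform_limit:
  fixes f :: "'k::topological_space \<Rightarrow>\<^sub>C complex"
  assumes lim: "uniform_limit (S \<union> scaleC_bcontfun \<i> ` S) (norm_quotient f) (\<lambda>_. 0) (at 0)"
  shows "norming_sequences_approach_on S f"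
  unfolding norming_sequences_approach_on_def
proof (intro allI impI, elim conjE)
  fix x y \<alpha> \<beta>
  assume x: "norming_sequence f \<alpha> x" and y: "norming_sequence f \<beta> y"
  then have ab: "cmod \<alpha> = 1" "cmod \<beta> = 1"
    by (auto simp: norming_sequence_def)
  let ?r = "\<lambda>n. Re (\<alpha> * f (x n) + \<beta> * f (y n))"
  have "?r \<longlonglongrightarrow> Re (complex_of_real (norm f) + complex_of_real (norm f))"
    using x y unfolding norming_sequence_def by (intro tendsto_Re tendsto_add) auto
  then have r: "?r \<longlonglongrightarrow> 2 * norm f"
    by simp
  show "uniform_limit S (\<lambda>n g. \<alpha> * g (x n) - \<beta> * g (y n)) (\<lambda>_. 0) sequentially"
  proof (rule uniform_limitI)
    fix e :: real assume "e > 0"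
    then have "\<forall>\<^sub>F t in at 0. \<forall>g \<in> S \<union> scaleC_bcontfun \<i> ` S. dist (norm_quotient f t g) 0 < e / 4"
      using uniform_limitD[OF lim, of "e / 4"] by simp
    then have "\<forall>\<^sub>F t in at_right 0. \<forall>g \<in> S \<union> scaleC_bcontfun \<i> ` S.
        dist (norm_quotient f t g) 0 < e / 4"
      by (simp add: eventually_at_split)
    \<comment> \<open>One positive \<open>t\<close>, good for all directions at once, is fixed
      before \<open>n\<close> tends to infinity.\<close>
    then have "\<exists>t::real. t > 0 \<and> (\<forall>g \<in> S \<union> scaleC_bcontfun \<i> ` S.
        dist (norm_quotient f t g) 0 < e / 4)"
      by (intro eventually_happens'[OF trivial_limit_at_right_real[of 0]]
          eventually_conj[OF eventually_at_right_less])
    then obtain t :: real where t: "t > 0"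
      "\<And>g. g \<in> S \<union> scaleC_bcontfun \<i> ` S \<Longrightarrow> \<bar>norm_quotient f t g\<bar> < e / 4"
      by (auto simp del: less_divide_eq_numeral1)
    \<comment> \<open>With \<open>t\<close> fixed, the norming defect may be required to be below
      \<open>t * (e / 4)\<close>, so it contributes less than \<open>e / 4\<close> after division by
      \<open>t\<close>. Quotient and defect then bound each of the real and imaginary parts by
      \<open>e / 2\<close>.\<close>
    have "\<forall>\<^sub>F n in sequentially. ?r n > 2 * norm f - t * (e / 4)"
      using order_tendstoD(1)[OF r] t(1) \<open>e > 0\<close> by simp
    then show "\<forall>\<^sub>F n in sequentially. \<forall>g\<in>S. dist (\<alpha> * g (x n) - \<beta> * g (y n)) 0 < e"
    proof eventually_elim
      case (elim n)
      then have r: "(2 * norm f - ?r n) / t < e / 4"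
        using t(1) by (simp add: field_simps)
      have Re: "\<bar>Re (\<alpha> * h (x n) - \<beta> * h (y n))\<bar> < e / 2"
        if "h \<in> S \<union> scaleC_bcontfun \<i> ` S" for h
        using Re_diff_le_norm_quotient[OF ab t(1), of h "x n" "y n" f] t(2)[OF that] r by linarith
      show ?case
      proof
        fix g assume "g \<in> S"
        let ?z = "\<alpha> * g (x n) - \<beta> * g (y n)"
        have "\<bar>Re ?z\<bar> < e / 2"
          using Re[of g] \<open>g \<in> S\<close> by simp
        moreover have "\<bar>Im ?z\<bar> < e / 2"
        proof -
          have "Re (\<alpha> * scaleC_bcontfun \<i> g (x n) - \<beta> * scaleC_bcontfun \<i> g (y n)) = - Im ?z"
            by simp
          then show ?thesis
            using Re[of "scaleC_bcontfun \<i> g"] \<open>g \<in> S\<close> by (metis UnCI abs_minus_cancel imageI)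
        qed
        ultimately show "dist ?z 0 < e"
          using cmod_le[of ?z] unfolding dist_norm diff_zero by linarith
      qed
    qed
  qed
qed

section \<open>From approaching norming sequences to differentiability\<close>

lemma near_norm_point:
  fixes h :: "'k::topological_space \<Rightarrow>\<^sub>C complex"
  assumes "e > 0"
  obtains x a where "cmod a = 1" "Re (a * h x) > norm h - e"
proof -
  have "\<exists>x. norm h - e < cmod (h x)"
    using less_cSUP_iff[of UNIV "\<lambda>x. cmod (h x)" "norm h - e"] assms
      bounded_norm_comp[of "apply_bcontfun h" UNIV]
    by (auto simp: norm_bcontfun_eq_SUP bounded_imp_bdd_above)
  then obtain x where x: "norm h - e < cmod (h x)" ..
  obtain a where "cmod a = 1" "a * h x = of_real (cmod (h x))"
  proof (cases "h x = 0")
    case True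
    then show ?thesis using that[of 1] by simp
  next
    case False
    show ?thesis
    proof (rule that)
      show "cmod (cnj (h x) / of_real (cmod (h x))) = 1"
        using False by (simp add: norm_divide)
      show "cnj (h x) / of_real (cmod (h x)) * h x = of_real (cmod (h x))"
        using False complex_norm_square[of "h x"] by (simp add: field_simps power2_eq_square)
    qed
  qed
  with x show thesis
    by (intro that[of a x]) (simp_all only: Re_complex_of_real)
qed

text \<open>Boundedness of \<open>S\<close> makes the perturbations
  \<open>t\<^sub>n g\<^sub>n\<close> tend to 0 in norm, so points almost norming
  \<open>f \<plusminus> t\<^sub>n g\<^sub>n\<close> also almost norm \<open>f\<close>.\<close>

lemma uniform_limit_norm_quotient_if_approach_on:
  fixes f :: "'k::topological_space \<Rightarrow>\<^sub>C complex"
  assumes "bounded S" and approach: "norming_sequences_approach_on S f"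
  shows "uniform_limit S (norm_quotient f) (\<lambda>_. 0) (at 0)"
proof (rule ccontr)
  assume "\<not> ?thesis"
  then obtain e where "e > 0"
    and e: "\<not> (\<forall>\<^sub>F t in at 0. \<forall>g\<in>S. dist (norm_quotient f t g) 0 < e)"
    by (auto simp: uniform_limit_iff)
  from \<open>bounded S\<close> obtain M where M: "\<And>g. g \<in> S \<Longrightarrow> norm g \<le> M"
    by (auto simp: bounded_iff)
  have gM: "cmod (g x) \<le> M" if "g \<in> S" for g x
    using norm_bounded[of g x] M[OF that] by simp
  have "\<exists>t g. 0 < t \<and> t < 1 / real (Suc n) \<and> g \<in> S \<and> norm_quotient f t g \<ge> e" for n
  proof -
    have "1 / real (Suc n) > 0"
      by simp
    with e obtain t :: real where "t \<noteq> 0" "\<bar>t\<bar> < 1 / real (Suc n)"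
      and "\<exists>g\<in>S. \<not> dist (norm_quotient f t g) 0 < e"
      unfolding eventually_at dist_real_def[of _ 0] diff_0_right by blast
    then show ?thesis
      by (intro exI[of _ "\<bar>t\<bar>"]) (auto simp: abs_norm_quotient not_less)
  qed
  then obtain t g where t: "\<And>n. 0 < t n" "\<And>n. t n < 1 / real (Suc n)"
    and g: "\<And>n::nat. g n \<in> S" "\<And>n. norm_quotient f (t n) (g n) \<ge> e"
    by metis
  \<comment> \<open>The tolerance is \<open>o(t n)\<close>, so that it still vanishes after the
    later division by \<open>t n\<close>.\<close>
  have "\<exists>a x. cmod a = 1 \<and> Re (a * (f + t n *\<^sub>R g n) x) > norm (f + t n *\<^sub>R g n) - t n / Suc n" for n
    using near_norm_point[of "t n / Suc n" "f + t n *\<^sub>R g n"] t(1)[of n] by (metis divide_pos_pos of_nat_0_less_iff zero_less_Suc)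
  then obtain a x where a: "\<And>n. cmod (a n) = 1"
    and x: "\<And>n. Re (a n * (f + t n *\<^sub>R g n) (x n)) > norm (f + t n *\<^sub>R g n) - t n / Suc n"
    by metis
  have "\<exists>b y. cmod b = 1 \<and> Re (b * (f - t n *\<^sub>R g n) y) > norm (f - t n *\<^sub>R g n) - t n / Suc n" for n
    using near_norm_point[of "t n / Suc n" "f - t n *\<^sub>R g n"] t(1)[of n] by (metis divide_pos_pos of_nat_0_less_iff zero_less_Suc)
  then obtain b y where b: "\<And>n. cmod (b n) = 1"
    and y: "\<And>n. Re (b n * (f - t n *\<^sub>R g n) (y n)) > norm (f - t n *\<^sub>R g n) - t n / Suc n"
    by metis
  \<comment> \<open>A norming sequence has one fixed scalar, whereas these phases vary with
    \<open>n\<close>. Compactness of the torus gives a single subsequence along which both phases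
    converge.\<close>
  have "compact (sphere (0::complex) 1 \<times> sphere (0::complex) 1)"
    by (intro compact_Times compact_sphere)
  then have "seq_compact (sphere (0::complex) 1 \<times> sphere (0::complex) 1)"
    by (rule compact_imp_seq_compact)
  then obtain l s where l: "l \<in> sphere (0::complex) 1 \<times> sphere (0::complex) 1"
    and s: "strict_mono s" and ls: "((\<lambda>n. (a n, b n)) \<circ> s) \<longlonglongrightarrow> l"
    using a b by (elim seq_compactE[of _ "\<lambda>n. (a n, b n)"]) auto
  obtain \<alpha> \<beta> where ab: "l = (\<alpha>, \<beta>)" "cmod \<alpha> = 1" "cmod \<beta> = 1"
    using l by auto
  have a_lim: "(\<lambda>n. a (s n)) \<longlonglongrightarrow> \<alpha>" and b_lim: "(\<lambda>n. b (s n)) \<longlonglongrightarrow> \<beta>"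
    using tendsto_fst[OF ls] tendsto_snd[OF ls] by (simp_all add: ab(1) o_def)
  have inv: "(\<lambda>n. 1 / real (Suc n)) \<longlonglongrightarrow> 0"
    by (rule LIMSEQ_Suc) (rule lim_1_over_n)
  have t0: "t \<longlonglongrightarrow> 0"
    by (rule tendsto_sandwich[OF _ _ tendsto_const inv]) (use t in \<open>simp_all add: less_imp_le del: of_nat_Suc\<close>)
  have t1: "(\<lambda>n. t n / Suc n) \<longlonglongrightarrow> 0"
    using tendsto_mult[OF t0 inv] by simp
  \<comment> \<open>Allowing \<open>h n\<close> or \<open>- h n\<close> in \<open>S\<close> treats
    \<open>f + t g\<close> and \<open>f - t g\<close> together, without assuming \<open>S\<close>
    symmetric.\<close>
  have norming: "norming_sequence f \<gamma> (u \<circ> s)"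
    if \<gamma>: "cmod \<gamma> = 1" and c: "\<And>n. cmod (c n) = 1" "(\<lambda>n. c (s n)) \<longlonglongrightarrow> \<gamma>"
      and h: "\<And>n. h n \<in> S \<or> - h n \<in> S"
      and u: "\<And>n. Re (c n * (f + t n *\<^sub>R h n) (u n)) > norm (f + t n *\<^sub>R h n) - t n / Suc n"
    for \<gamma> c u h
  proof -
    have hM: "cmod (h n z) \<le> M" "norm (h n) \<le> M" for n z
      using h[of n] gM[of "h n" z] gM[of "- h n" z] M[of "h n"] M[of "- h n"] by auto
    \<comment> \<open>The perturbation, of norm at most \<open>M * t n\<close>, is paid for twice:
      in comparing the norms, and in removing it from the evaluation at \<open>u n\<close>.\<close>
    have Re_lower: "Re (c n * f (u n)) \<ge> norm f - (2 * M * t n + t n / Suc n)" for n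
    proof -
      have "norm f - norm (t n *\<^sub>R h n) \<le> norm (f + t n *\<^sub>R h n)"
        by (metis add_diff_cancel norm_triangle_ineq2 norm_minus_commute diff_le_eq norm_triangle_ineq4)
      moreover have "norm (t n *\<^sub>R h n) \<le> t n * M"
        using t(1)[of n] hM(2)[of n] by (simp add: mult_left_mono)
      moreover have "Re (c n * (t n *\<^sub>R h n) (u n)) \<le> norm (t n *\<^sub>R h n)"
        using c(1) by (rule Re_mult_le_norm_bcontfun)
      moreover have "Re (c n * (f + t n *\<^sub>R h n) (u n))
          = Re (c n * f (u n)) + Re (c n * (t n *\<^sub>R h n) (u n))"
        by (simp add: algebra_simps)
      ultimately show ?thesis
        using u[of n] by (simp add: algebra_simps)
    qed
    have Re_lim: "(\<lambda>n. Re (c n * f (u n))) \<longlonglongrightarrow> norm f"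
    proof (rule tendsto_sandwich)
      show "(\<lambda>n. norm f - (2 * M * t n + t n / Suc n)) \<longlonglongrightarrow> norm f"
        using tendsto_diff[OF tendsto_const[of "norm f"]
            tendsto_add[OF tendsto_mult_left[OF t0, of "2 * M"] t1]] by simp
      show "\<forall>\<^sub>F n in sequentially. norm f - (2 * M * t n + t n / Suc n) \<le> Re (c n * f (u n))"
        using Re_lower by simp
      show "\<forall>\<^sub>F n in sequentially. Re (c n * f (u n)) \<le> norm f"
        by (intro always_eventually allI Re_mult_le_norm_bcontfun c)
    qed simp
    \<comment> \<open>The modulus is at most \<open>norm f\<close> and the real part tends to
      \<open>norm f\<close>, which leaves no room for the imaginary part.\<close>
    have "(\<lambda>n. Im (c n * f (u n))) \<longlonglongrightarrow> 0"
    proof -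
      have "(\<lambda>n. sqrt ((norm f)\<^sup>2 - (Re (c n * f (u n)))\<^sup>2)) \<longlonglongrightarrow> sqrt ((norm f)\<^sup>2 - (norm f)\<^sup>2)"
        by (intro tendsto_intros Re_lim)
      then have lim: "(\<lambda>n. sqrt ((norm f)\<^sup>2 - (Re (c n * f (u n)))\<^sup>2)) \<longlonglongrightarrow> 0"
        by simp
      have "\<bar>Im (c n * f (u n))\<bar> \<le> sqrt ((norm f)\<^sup>2 - (Re (c n * f (u n)))\<^sup>2)" for n
      proof (rule real_le_rsqrt)
        have "cmod (c n * f (u n)) \<le> norm f"
          using norm_bounded[of f "u n"] by (simp add: norm_mult c(1))
        then have "(cmod (c n * f (u n)))\<^sup>2 \<le> (norm f)\<^sup>2"
          by (intro power_mono) auto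
        then show "\<bar>Im (c n * f (u n))\<bar>\<^sup>2 \<le> (norm f)\<^sup>2 - (Re (c n * f (u n)))\<^sup>2"
          unfolding cmod_power2 power2_abs by linarith
      qed
      then show ?thesis
        by (intro Lim_null_comparison[OF _ lim]) simp
    qed
    with Re_lim have "(\<lambda>n. c n * f (u n)) \<longlonglongrightarrow> complex_of_real (norm f)"
      by (simp add: tendsto_complex_iff)
    from LIMSEQ_subseq_LIMSEQ[OF this s]
    have 1: "(\<lambda>n. c (s n) * f (u (s n))) \<longlonglongrightarrow> complex_of_real (norm f)"
      by (simp add: o_def)
    \<comment> \<open>This is the cost of replacing the varying phase by its limit.\<close>
    have 2: "(\<lambda>n. (\<gamma> - c (s n)) * f (u (s n))) \<longlonglongrightarrow> 0"
    proof (rule Lim_null_comparison)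
      show "\<forall>\<^sub>F n in sequentially. norm ((\<gamma> - c (s n)) * f (u (s n))) \<le> cmod (\<gamma> - c (s n)) * norm f"
        by (auto simp: norm_mult intro!: mult_left_mono norm_bounded always_eventually)
      have "(\<lambda>n. cmod (\<gamma> - c (s n)) * norm f) \<longlonglongrightarrow> cmod (\<gamma> - \<gamma>) * norm f"
        by (intro tendsto_intros c)
      then show "(\<lambda>n. cmod (\<gamma> - c (s n)) * norm f) \<longlonglongrightarrow> 0" by simp
    qed
    from tendsto_add[OF 1 2] show ?thesis
      using \<gamma> by (simp add: norming_sequence_def algebra_simps)
  qed
  have "norming_sequence f \<alpha> (x \<circ> s)"
    by (rule norming[OF ab(2) a a_lim _ x]) (simp add: g)
  moreover have "norming_sequence f \<beta> (y \<circ> s)"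
    by (rule norming[OF ab(3) b b_lim, of "\<lambda>n. - g n"]) (use g y in auto)
  ultimately have "uniform_limit S (\<lambda>n h. \<alpha> * h (x (s n)) - \<beta> * h (y (s n))) (\<lambda>_. 0) sequentially"
    using approach unfolding norming_sequences_approach_on_def o_def by blast
  then have small: "\<forall>\<^sub>F n in sequentially. \<forall>h\<in>S. cmod (\<alpha> * h (x (s n)) - \<beta> * h (y (s n))) < e / 2"
    using \<open>e > 0\<close> by (auto simp: uniform_limit_iff dest!: spec[of _ "e / 2"])
  \<comment> \<open>Subtracting the values of \<open>f\<close>, each at most \<open>norm f\<close>,
    leaves only the terms in \<open>g n\<close>. Dividing by \<open>t n\<close> turns the two
    tolerances into \<open>2 / Suc n\<close>.\<close>
  have large: "e \<le> Re (a n * g n (x n) - b n * g n (y n)) + 2 / real (Suc n)" for n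
  proof -
    have "e * t n \<le> norm (f + t n *\<^sub>R g n) + norm (f - t n *\<^sub>R g n) - 2 * norm f"
      using g(2)[of n] t(1)[of n] by (simp add: norm_quotient_def field_simps)
    also have "\<dots> \<le> Re (a n * (f + t n *\<^sub>R g n) (x n)) + t n / Suc n
        + (Re (b n * (f - t n *\<^sub>R g n) (y n)) + t n / Suc n)
        - (Re (a n * f (x n)) + Re (b n * f (y n)))"
      using x[of n] y[of n] Re_mult_le_norm_bcontfun[OF a, of n f "x n"]
        Re_mult_le_norm_bcontfun[OF b, of n f "y n"] by linarith
    also have "\<dots> = (Re (a n * g n (x n) - b n * g n (y n)) + 2 / real (Suc n)) * t n"
      by (simp add: algebra_simps)
    finally show ?thesis
      using t(1)[of n] by simp
  qed
  \<comment> \<open>This collects the errors from passing to the limit phases, uniform in the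
    direction because values are bounded by \<open>M\<close>, and the tolerances. Together with
    \<open>small\<close> the total drops below \<open>e\<close>, against
    \<open>large\<close>.\<close>
  let ?err = "\<lambda>n. cmod (a (s n) - \<alpha>) * M + cmod (b (s n) - \<beta>) * M + 2 * (1 / real (Suc (s n)))"
  have "?err \<longlonglongrightarrow> cmod (\<alpha> - \<alpha>) * M + cmod (\<beta> - \<beta>) * M + 2 * 0"
    using LIMSEQ_subseq_LIMSEQ[OF inv s]
    by (intro tendsto_intros a_lim b_lim) (simp add: o_def)
  then have "\<forall>\<^sub>F n in sequentially. ?err n < e / 2"
    using \<open>e > 0\<close> by (intro order_tendstoD(2)) auto
  with small have "\<forall>\<^sub>F n in sequentially. False"
  proof eventually_elim
    case (elim n)
    let ?g = "g (s n)" and ?x = "x (s n)" and ?y = "y (s n)"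
    have "a (s n) * ?g ?x - b (s n) * ?g ?y
        = (\<alpha> * ?g ?x - \<beta> * ?g ?y) + (a (s n) - \<alpha>) * ?g ?x - (b (s n) - \<beta>) * ?g ?y"
      by (simp add: algebra_simps)
    also have "Re \<dots> \<le> cmod (\<alpha> * ?g ?x - \<beta> * ?g ?y) + cmod ((a (s n) - \<alpha>) * ?g ?x)
        + cmod ((b (s n) - \<beta>) * ?g ?y)"
      using complex_Re_le_cmod[of "\<alpha> * ?g ?x - \<beta> * ?g ?y"] complex_Re_le_cmod[of "(a (s n) - \<alpha>) * ?g ?x"]
        abs_Re_le_cmod[of "(b (s n) - \<beta>) * ?g ?y"]
      unfolding minus_complex.simps(1) plus_complex.simps(1) by linarith
    finally have "Re (a (s n) * ?g ?x - b (s n) * ?g ?y)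
        \<le> cmod (\<alpha> * ?g ?x - \<beta> * ?g ?y) + cmod ((a (s n) - \<alpha>) * ?g ?x)
          + cmod ((b (s n) - \<beta>) * ?g ?y)" .
    moreover have "cmod ((a (s n) - \<alpha>) * ?g ?x) \<le> cmod (a (s n) - \<alpha>) * M"
      "cmod ((b (s n) - \<beta>) * ?g ?y) \<le> cmod (b (s n) - \<beta>) * M"
      using gM[OF g(1)] by (auto simp: norm_mult intro!: mult_left_mono)
    moreover have "cmod (\<alpha> * ?g ?x - \<beta> * ?g ?y) < e / 2"
      using elim(1) g(1) by blast
    ultimately show False
      using large[of "s n"] elim(2) by linarith
  qed
  then show False by simp
qed

section \<open>Specialisation to singletons and to the unit sphere\<close>

lemma norm_scaleC_bcontfun:
  fixes f :: "'k::topological_space \<Rightarrow>\<^sub>C complex"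
  assumes "cmod c = 1"
  shows "norm (scaleC_bcontfun c f) = norm f"
  by (simp add: norm_bcontfun_eq_SUP norm_mult assms)

theorem theorem2p2:
  fixes A :: "('k::t2_space \<Rightarrow>\<^sub>C complex) set" and f :: "'k \<Rightarrow>\<^sub>C complex"
  assumes "closed_subspace A" and "f \<in> A"
  shows "(gateaux_differentiable_norm A f \<longleftrightarrow> norming_sequences_approach A f) \<and>
    (frechet_differentiable_norm A f \<longleftrightarrow> norming_sequences_approach_uniformly A f)"
proof (intro conjI iffI)
  have scale: "scaleC_bcontfun c g \<in> A" if "g \<in> A" for c g
    using assms(1) that by (simp add: closed_subspace_def Cb.subspace_scale)
  show "norming_sequences_approach A f" if "gateaux_differentiable_norm A f"
    unfolding norming_sequences_approach_iff
  proof
    fix g assume "g \<in> A"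
    with that scale have "uniform_limit ({g} \<union> {scaleC_bcontfun \<i> g}) (norm_quotient f) (\<lambda>_. 0) (at 0)"
      unfolding gateaux_differentiable_norm_iff by (intro uniform_limit_on_Un) auto
    then show "norming_sequences_approach_on {g} f"
      by (intro norming_sequences_approach_on_if_uniform_limit) simp
  qed
  show "gateaux_differentiable_norm A f" if "norming_sequences_approach A f"
    using that unfolding norming_sequences_approach_iff gateaux_differentiable_norm_iff
    by (blast intro: uniform_limit_norm_quotient_if_approach_on bounded_insert[THEN iffD2] bounded_empty)
  have approach_uniformly_iff: "norming_sequences_approach_uniformly A f
      \<longleftrightarrow> norming_sequences_approach_on (A \<inter> sphere 0 1) f"
    by (simp add: norming_sequences_approach_uniformly_def norming_sequences_approach_on_def)
  show "norming_sequences_approach_uniformly A f" if "frechet_differentiable_norm A f"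
  proof -
    \<comment> \<open>Multiplication by \<open>\<i>\<close> preserves the unit sphere of
      \<open>A\<close>, so the enlarged set of directions is the sphere itself.\<close>
    have "scaleC_bcontfun \<i> ` (A \<inter> sphere 0 1) \<subseteq> A \<inter> sphere 0 1"
      using scale by (auto simp: norm_scaleC_bcontfun)
    then have "A \<inter> sphere 0 1 \<union> scaleC_bcontfun \<i> ` (A \<inter> sphere 0 1) = A \<inter> sphere 0 1"
      by blast
    with that show ?thesis
      unfolding approach_uniformly_iff frechet_differentiable_norm_iff
      by (intro norming_sequences_approach_on_if_uniform_limit) simp
  qed
  show "frechet_differentiable_norm A f" if "norming_sequences_approach_uniformly A f"
    using that unfolding approach_uniformly_iff frechet_differentiable_norm_iff
    by (intro uniform_limit_norm_quotient_if_approach_on) (auto simp: bounded_iff)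
qed

end
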